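(* Let $\eta(\theta)=(\eta_{ki}(\theta))_{1\leq k,i\leq n}$, $\theta\in[-\tau,0]$, be the real $n\times n$ matrix-valued function of bounded variation defining the linear part $L\phi=\int_{-\tau}^{0}d\eta(\theta)\,\phi(\theta)$ of a $\mathbf{D}_n$-equivariant delay-coupled system of $n$ identical one-dimensional cells, so that $\eta(\theta)$ commutes with the action of $\mathbf{D}_n$ on $\mathbb{R}^n$ for every $\theta$. Then $\eta(\theta)$ is symmetric, $\eta(\theta)=\eta(\theta)^{T}$, and has the following properties: 1. for all $j=1,\ldots,n$, $\eta_{jj}(\theta)=p(\theta)$ for some function $p$ (independent of $j$); 2. for all $i=1,\ldots,n$ and $k=2,\ldots,n$, with row indices read modulo $n$ in $\{1,\ldots,n\}$, $$\eta_{(i+k-1)\,i}(\theta)=\eta_{(i+n+1-k)\,i}(\theta)=\eta_{k1}(\theta).$$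
   Context: $\mathbf{D}_n$ is the dihedral group with generators $\rho,\kappa$ acting on $\mathbb{R}^n$ by $\rho\cdot(x_1,\ldots,x_n)=(x_n,x_1,\ldots,x_{n-1})$ and: if $n$ is odd, $\kappa\cdot(x_1,x_2,\ldots,x_n)=(x_1,x_n,x_{n-1},\ldots,x_2)$ (position $j\geq 2$ receives $x_{n+2-j}$); if $n$ is even, $\kappa\cdot(x_1,\ldots,x_n)=(x_n,x_{n-1},\ldots,x_1)$. The entry $\eta_{ki}$ is the element of $\eta$ corresponding to the coupling from cell $k$ to cell $i$; in particular $\eta_{k1}$ is the coupling from cell $k$ to cell $1$. *)

theory Defs
  imports
    "HOL-Analysis.Analysis"
    "HOL-Algebra.Bij"
    "HOL-Algebra.Generated_Groups"
    "Jordan_Normal_Form.Matrix"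
begin

text \<open>Vectors and matrices are indexed from 0, so the 1-based coordinate \<open>x\<^sub>m\<close> is \<open>x $ (m - 1)\<close>.\<close>

definition rho :: "nat \<Rightarrow> real vec \<Rightarrow> real vec" where
  "rho n = (\<lambda>x \<in> carrier_vec n. vec n (\<lambda>j. if j = 0 then x $ (n - 1) else x $ (j - 1)))"

definition kappa :: "nat \<Rightarrow> real vec \<Rightarrow> real vec" where
  "kappa n = (\<lambda>x \<in> carrier_vec n.
     if odd n then vec n (\<lambda>j. if j = 0 then x $ 0 else x $ (n - j))
     else vec n (\<lambda>j. x $ (n - 1 - j)))"

text \<open>The group of transformations of \<open>\<real>\<^sup>n\<close> by which the dihedral group acts. The maps
  are restricted to \<open>carrier_vec n\<close> because elements of \<open>BijGroup\<close> must be extensional.\<close>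

definition dihedral :: "nat \<Rightarrow> (real vec \<Rightarrow> real vec) set" where
  "dihedral n = generate (BijGroup (carrier_vec n)) {rho n, kappa n}"

definition commutes_with_dihedral :: "nat \<Rightarrow> real mat \<Rightarrow> bool" where
  "commutes_with_dihedral n A \<longleftrightarrow>
     (\<forall>\<gamma> \<in> dihedral n. \<forall>x \<in> carrier_vec n. A *\<^sub>v \<gamma> x = \<gamma> (A *\<^sub>v x))"

definition bounded_variation :: "real \<Rightarrow> real \<Rightarrow> (real \<Rightarrow> real) \<Rightarrow> bool" where
  "bounded_variation a b g \<longleftrightarrow>
     (\<exists>M. \<forall>N t. t 0 = a \<and> t N = b \<and> (\<forall>j<N. t j \<le> t (Suc j))
        \<longrightarrow> (\<Sum>j<N. \<bar>g (t (Suc j)) - g (t j)\<bar>) \<le> M)"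

definition bounded_variation_mat :: "nat \<Rightarrow> real \<Rightarrow> real \<Rightarrow> (real \<Rightarrow> real mat) \<Rightarrow> bool" where
  "bounded_variation_mat n a b \<eta> \<longleftrightarrow>
     (\<forall>k<n. \<forall>i<n. bounded_variation a b (\<lambda>\<theta>. \<eta> \<theta> $$ (k, i)))"

text \<open>Riemann--Stieltjes integral of \<open>f\<close> against \<open>dg\<close>, as a limit of mesh to 0; it exists for
  continuous \<open>f\<close> and \<open>g\<close> of bounded variation, and is unique when \<open>a \<le> b\<close>.\<close>

definition has_stieltjes_integral ::
    "real \<Rightarrow> real \<Rightarrow> (real \<Rightarrow> real) \<Rightarrow> (real \<Rightarrow> real) \<Rightarrow> real \<Rightarrow> bool" where
  "has_stieltjes_integral a b g f I \<longleftrightarrow>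
     (\<forall>\<epsilon>>0. \<exists>\<delta>>0. \<forall>N t \<xi>.
        t 0 = a \<and> t N = b \<and>
        (\<forall>j<N. t j \<le> \<xi> j \<and> \<xi> j \<le> t (Suc j) \<and> t (Suc j) - t j < \<delta>)
        \<longrightarrow> \<bar>(\<Sum>j<N. (g (t (Suc j)) - g (t j)) * f (\<xi> j)) - I\<bar> < \<epsilon>)"

definition stieltjes_integral ::
    "real \<Rightarrow> real \<Rightarrow> (real \<Rightarrow> real) \<Rightarrow> (real \<Rightarrow> real) \<Rightarrow> real" where
  "stieltjes_integral a b g f = (THE I. has_stieltjes_integral a b g f I)"

definition phase_space :: "nat \<Rightarrow> real \<Rightarrow> (real \<Rightarrow> real vec) set" where
  "phase_space n \<tau> =
     {\<phi>. (\<forall>\<theta>\<in>{-\<tau>..0}. \<phi> \<theta> \<in> carrier_vec n) \<and>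
         (\<forall>i<n. continuous_on {-\<tau>..0} (\<lambda>\<theta>. \<phi> \<theta> $ i))}"

definition delay_operator ::
    "nat \<Rightarrow> real \<Rightarrow> (real \<Rightarrow> real mat) \<Rightarrow> (real \<Rightarrow> real vec) \<Rightarrow> real vec" where
  "delay_operator n \<tau> \<eta> \<phi> =
     vec n (\<lambda>k. \<Sum>i<n. stieltjes_integral (-\<tau>) 0 (\<lambda>\<theta>. \<eta> \<theta> $$ (k, i)) (\<lambda>\<theta>. \<phi> \<theta> $ i))"

definition dihedral_equivariant ::
    "nat \<Rightarrow> real \<Rightarrow> ((real \<Rightarrow> real vec) \<Rightarrow> real vec) \<Rightarrow> bool" where
  "dihedral_equivariant n \<tau> L \<longleftrightarrow>
     (\<forall>\<gamma> \<in> dihedral n. \<forall>\<phi> \<in> phase_space n \<tau>. L (\<lambda>\<theta>. \<gamma> (\<phi> \<theta>)) = \<gamma> (L \<phi>))"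

text \<open>The entry with 1-based row \<open>k\<close> and column \<open>i\<close>, both read modulo \<open>n\<close> in \<open>{1..n}\<close>
  (for indices \<open>\<ge> 1\<close>; natural-number subtraction).\<close>

definition entry :: "nat \<Rightarrow> real mat \<Rightarrow> nat \<Rightarrow> nat \<Rightarrow> real" where
  "entry n A k i = A $$ ((k - 1) mod n, (i - 1) mod n)"

end

theory Submission
  imports Defs
begin

text \<open>Commuting with a coordinate permutation \<open>\<sigma>\<close> means \<open>A (\<sigma> j, \<sigma> b) = A (j, b)\<close>, as one sees
  on unit vectors. The rotation makes \<open>A\<close> circulant, hence determined by its first column, and the
  reflection makes that column invariant under \<open>m \<mapsto> - m\<close> modulo \<open>n\<close>.\<close>

lemma entry_invariant_under_commuting_permutation:
  fixes A :: "real mat"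
  assumes A: "A \<in> carrier_mat n n"
    and comm: "\<forall>x \<in> carrier_vec n. A *\<^sub>v \<gamma> x = \<gamma> (A *\<^sub>v x)"
    and \<gamma>: "\<And>x. x \<in> carrier_vec n \<Longrightarrow> \<gamma> x = vec n (\<lambda>j. x $ \<sigma> j)"
    and \<sigma>: "\<And>j. j < n \<Longrightarrow> \<sigma> j < n" "inj_on \<sigma> {..<n}"
    and jb: "j < n" "b < n"
  shows "A $$ (\<sigma> j, \<sigma> b) = A $$ (j, b)"
proof -
  let ?x = "unit_vec n (\<sigma> b) :: real vec"
  \<comment> \<open>Position \<open>j\<close> of the image reads coordinate
    \<open>\<sigma> j\<close>, so a 1 appears exactly where \<open>\<sigma> j = \<sigma> b\<close>;
    injectivity leaves only \<open>j = b\<close>.\<close>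
  have "\<gamma> ?x = unit_vec n b"
    using \<sigma> jb by (auto simp: \<gamma> unit_vec_def inj_on_eq_iff)
  then have "(A *\<^sub>v \<gamma> ?x) $ j = A $$ (j, b)"
    using A jb by simp
  moreover have "\<gamma> (A *\<^sub>v ?x) $ j = A $$ (\<sigma> j, \<sigma> b)"
    using A jb \<sigma>(1) by (subst \<gamma>) auto
  ultimately show ?thesis using comm by simp
qed

lemma rho_in_dihedral: "rho n \<in> dihedral n"
  and kappa_in_dihedral: "kappa n \<in> dihedral n"
  unfolding dihedral_def by (auto intro: generate.incl)

lemma commutes_with_dihedral_entry_rho:
  assumes "A \<in> carrier_mat n n" "commutes_with_dihedral n A" "j < n" "b < n"
  shows "A $$ (if j = 0 then n - 1 else j - 1, if b = 0 then n - 1 else b - 1) = A $$ (j, b)"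
proof (rule entry_invariant_under_commuting_permutation[where \<gamma> = "rho n"])
  show "\<forall>x\<in>carrier_vec n. A *\<^sub>v rho n x = rho n (A *\<^sub>v x)"
    using assms rho_in_dihedral by (auto simp: commutes_with_dihedral_def)
  show "inj_on (\<lambda>j. if j = 0 then n - 1 else j - 1) {..<n}"
    by (auto simp: inj_on_def)
qed (use assms in \<open>auto simp: rho_def if_distrib\<close>)

lemma commutes_with_dihedral_entry_kappa:
  assumes "A \<in> carrier_mat n n" "commutes_with_dihedral n A" "j < n" "b < n"
  defines "\<sigma> \<equiv> \<lambda>j. if odd n then if j = 0 then 0 else n - j else n - 1 - j"
  shows "A $$ (\<sigma> j, \<sigma> b) = A $$ (j, b)"
proof (rule entry_invariant_under_commuting_permutation[where \<gamma> = "kappa n"])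
  show "\<forall>x\<in>carrier_vec n. A *\<^sub>v kappa n x = kappa n (A *\<^sub>v x)"
    using assms kappa_in_dihedral by (auto simp: commutes_with_dihedral_def)
  show "inj_on \<sigma> {..<n}"
    by (auto simp: inj_on_def \<sigma>_def)
qed (use assms in \<open>auto simp: kappa_def \<sigma>_def intro!: eq_vecI\<close>)

text \<open>Each application of the rotation moves one step back along a cyclic diagonal, so
  \<open>b\<close> steps reach column 0. The summand \<open>n\<close> keeps the subtraction of
  naturals from truncating.\<close>

lemma commutes_with_dihedral_circulant:
  assumes "A \<in> carrier_mat n n" "commutes_with_dihedral n A" "a < n" "b < n"
  shows "A $$ (a, b) = A $$ ((a + n - b) mod n, 0)"
  using assms(3,4)
proof (induction b arbitrary: a)
  case 0
  then show ?case by simp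
next
  case (Suc b)
  let ?a = "if a = 0 then n - 1 else a - 1"
  have "A $$ (a, Suc b) = A $$ (?a, b)"
    using commutes_with_dihedral_entry_rho[OF assms(1,2) Suc.prems] by simp
  also have "\<dots> = A $$ ((?a + n - b) mod n, 0)"
    using Suc by simp
  also have "(?a + n - b) mod n = (a + n - Suc b) mod n"
  proof (cases "a = 0")
    case True
    \<comment> \<open>Stepping back from row 0 wraps to row \<open>n - 1\<close>, which adds one
      full period.\<close>
    then have "?a + n - b = (a + n - Suc b) + n" using Suc.prems by simp
    then show ?thesis by (simp only: mod_add_self2)
  qed simp
  finally show ?case .
qed

text \<open>For odd \<open>n\<close> the reflection fixes index 0 and so maps column 0 to itself.
  For even \<open>n\<close> it sends column 0 to column \<open>n - 1\<close>, and circulance carries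
  that back to column 0. The \<open>mod n\<close> covers \<open>a = 0\<close>.\<close>

lemma commutes_with_dihedral_column_reflection:
  assumes "A \<in> carrier_mat n n" "commutes_with_dihedral n A" "a < n"
  shows "A $$ (a, 0) = A $$ ((n - a) mod n, 0)"
proof (cases "odd n")
  case True
  then show ?thesis
    using commutes_with_dihedral_entry_kappa[OF assms, of 0] assms(3) by (auto split: if_splits)
next
  case False
  then have "A $$ (a, 0) = A $$ (n - 1 - a, n - 1)"
    using commutes_with_dihedral_entry_kappa[OF assms, of 0] assms(3) by simp
  also have "\<dots> = A $$ ((n - 1 - a + n - (n - 1)) mod n, 0)"
    using assms(3) by (intro commutes_with_dihedral_circulant[OF assms(1,2)]) auto
  also have "n - 1 - a + n - (n - 1) = n - a"
    using assms(3) by simp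
  finally show ?thesis .
qed

text \<open>By circulance, the entries at \<open>(i, j)\<close> and \<open>(j, i)\<close> are those
  of column 0 at \<open>i - j\<close> and \<open>j - i\<close> modulo \<open>n\<close>, which the
  reflection identifies.\<close>

lemma commutes_with_dihedral_symmetric:
  assumes "A \<in> carrier_mat n n" "commutes_with_dihedral n A"
  shows "A = transpose_mat A"
proof (rule eq_matI)
  fix i j
  assume "i < dim_row (transpose_mat A)" "j < dim_col (transpose_mat A)"
  then have ij: "i < n" "j < n" using assms(1) by auto
  \<comment> \<open>This is \<open>-(i - j) = j - i\<close> modulo \<open>n\<close>; the outer
    \<open>mod n\<close> on the left matters only for \<open>i = j\<close>, where it turns
    \<open>n\<close> into 0.\<close>
  have "(n - (i + n - j) mod n) mod n = (j + n - i) mod n"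
  proof (cases i j rule: linorder_cases)
    case less
    then have "j + n - i = (j - i) + n" by simp
    then have "(j + n - i) mod n = j - i"
      using ij by (simp only: mod_add_self2) simp
    then show ?thesis using ij less by simp
  next
    case equal
    then show ?thesis using ij by simp
  next
    case greater
    then have "i + n - j = (i - j) + n" by simp
    then have "(i + n - j) mod n = i - j"
      using ij by (simp only: mod_add_self2) simp
    then show ?thesis using ij greater by simp
  qed
  moreover have "A $$ (i, j) = A $$ ((n - (i + n - j) mod n) mod n, 0)"
    using commutes_with_dihedral_circulant[OF assms ij]
      commutes_with_dihedral_column_reflection[OF assms, of "(i + n - j) mod n"] ij by simp
  ultimately show "A $$ (i, j) = transpose_mat A $$ (i, j)"
    using commutes_with_dihedral_circulant[OF assms ij(2,1)] ij assms(1) by simp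
qed (use assms in auto)

text \<open>Translates circulance to 1-based cyclic indices, with \<open>m\<close> the offset from
  the diagonal: 0 gives the diagonal, \<open>k - 1\<close> and \<open>n + 1 - k\<close> the two
  off-diagonal families.\<close>

lemma commutes_with_dihedral_entry_shift:
  assumes "A \<in> carrier_mat n n" "commutes_with_dihedral n A" "i \<in> {1..n}"
  shows "entry n A (i + m) i = A $$ (m mod n, 0)"
proof -
  have "((i + m - 1) mod n + n - (i - 1)) mod n = ((i + m - 1) mod n + (n - (i - 1))) mod n"
    using assms(3) by simp
  also have "\<dots> = (i + m - 1 + (n - (i - 1))) mod n"
    by (simp only: mod_add_left_eq)
  also have "i + m - 1 + (n - (i - 1)) = m + n"
    using assms(3) by simp
  finally have "((i + m - 1) mod n + n - (i - 1)) mod n = m mod n"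
    by simp
  moreover have "i - 1 < n"
    using assms(3) by auto
  ultimately show ?thesis
    using commutes_with_dihedral_circulant[OF assms(1,2), of "(i + m - 1) mod n" "i - 1"]
    by (simp add: entry_def)
qed

theorem proposition3p4:
  fixes n :: nat and \<tau> :: real and \<eta> :: "real \<Rightarrow> real mat"
  assumes "1 \<le> n" and "0 \<le> \<tau>"
    and "\<forall>\<theta>\<in>{-\<tau>..0}. \<eta> \<theta> \<in> carrier_mat n n"
    and "bounded_variation_mat n (-\<tau>) 0 \<eta>"
    and "dihedral_equivariant n \<tau> (delay_operator n \<tau> \<eta>)"
    and "\<forall>\<theta>\<in>{-\<tau>..0}. commutes_with_dihedral n (\<eta> \<theta>)"
  shows "(\<forall>\<theta>\<in>{-\<tau>..0}. \<eta> \<theta> = transpose_mat (\<eta> \<theta>)) \<and>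
    (\<exists>p :: real \<Rightarrow> real. \<forall>\<theta>\<in>{-\<tau>..0}. \<forall>j\<in>{1..n}. entry n (\<eta> \<theta>) j j = p \<theta>) \<and>
    (\<forall>\<theta>\<in>{-\<tau>..0}. \<forall>i\<in>{1..n}. \<forall>k\<in>{2..n}.
       entry n (\<eta> \<theta>) (i + k - 1) i = entry n (\<eta> \<theta>) (i + n + 1 - k) i \<and>
       entry n (\<eta> \<theta>) (i + n + 1 - k) i = entry n (\<eta> \<theta>) k 1)"
proof (intro conjI ballI)
  fix \<theta> assume "\<theta> \<in> {-\<tau>..0}"
  then show "\<eta> \<theta> = transpose_mat (\<eta> \<theta>)"
    using assms(3,6) commutes_with_dihedral_symmetric by blast
next
  show "\<exists>p. \<forall>\<theta>\<in>{-\<tau>..0}. \<forall>j\<in>{1..n}. entry n (\<eta> \<theta>) j j = p \<theta>"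
    using assms(3,6) commutes_with_dihedral_entry_shift[where m = 0]
    \<comment> \<open>The common diagonal value \<open>p\<close> is the top left entry.\<close>
    by (intro exI[of _ "\<lambda>\<theta>. \<eta> \<theta> $$ (0, 0)"]) simp
next
  fix \<theta> i k
  assume \<theta>: "\<theta> \<in> {-\<tau>..0}" and i: "i \<in> {1..n}" and k: "k \<in> {2..n}"
  let ?A = "\<eta> \<theta>"
  have A: "?A \<in> carrier_mat n n" "commutes_with_dihedral n ?A"
    using assms(3,6) \<theta> by auto
  have "?A $$ (k - 1, 0) = ?A $$ ((n - (k - 1)) mod n, 0)"
    using k by (intro commutes_with_dihedral_column_reflection[OF A]) auto
  \<comment> \<open>Here \<open>k \<ge> 2\<close> puts the reflected index below
    \<open>n\<close>.\<close>
  moreover have "(n - (k - 1)) mod n = n + 1 - k"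
    using k by auto
  ultimately have reflect: "?A $$ (n + 1 - k, 0) = ?A $$ (k - 1, 0)"
    by simp
  have mods: "(k - 1) mod n = k - 1" "(n + 1 - k) mod n = n + 1 - k"
    using k by auto
  then have k1: "entry n ?A k 1 = ?A $$ (k - 1, 0)"
    by (simp add: entry_def)
  have "entry n ?A (i + k - 1) i = ?A $$ (k - 1, 0)"
    using commutes_with_dihedral_entry_shift[OF A i, of "k - 1"] k mods by simp
  \<comment> \<open>As \<open>k \<le> n\<close>, the row index regroups as
    \<open>i + (n + 1 - k)\<close> without truncation.\<close>
  moreover have far: "entry n ?A (i + n + 1 - k) i = ?A $$ (n + 1 - k, 0)"
    using commutes_with_dihedral_entry_shift[OF A i, of "n + 1 - k"] k mods by simp
  ultimately show "entry n ?A (i + k - 1) i = entry n ?A (i + n + 1 - k) i"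
    using reflect by simp
  show "entry n ?A (i + n + 1 - k) i = entry n ?A k 1"
    using far reflect k1 by simp
qed

end
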